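(* Consider a reversible-irreversible port-Hamiltonian system (RIPHS) on an open set $\mathbb X\subset\mathbb R^n$, written $\dot x=f(x,u)$, let $\mathbb U\subset\mathbb R^m$ be compact and convex with $0\in\operatorname{int}\mathbb U$, and let $\alpha_1,\alpha_2>0$, $T_0>0$. If $(\bar x,\bar u)\in\mathbb X\times\mathbb U$ is a steady state, i.e. $f(\bar x,\bar u)=0$, then $$\ell_{\alpha_1,\alpha_2}(\bar x,\bar u)=\alpha_2T_0\sum_{k=1}^N\gamma_k(\bar x,H_x(\bar x))\,\{S,H\}_{J_k}^2(\bar x)\ \ge 0 .$$ In particular, the optimal value of the steady-state problem $$\min_{(\bar x,\bar u)\in\mathbb X\times\mathbb U}\ell_{\alpha_1,\alpha_2}(\bar x,\bar u)\quad\text{s.t. } f(\bar x,\bar u)=0$$ is always non-negative, and it is zero if and only if the set $$\mathcal S=\{(\bar x,\bar u)\in\mathcal T\times\mathbb U: g(\bar x,H_x(\bar x))\bar u=-J_0(\bar x)H_x(\bar x)\}$$ is non-empty. In this case, $\mathcal S$ coincides with the set of optimal steady states (i.e. the set of solutions of the steady-state problem). If $H_x(\hat x)\in\operatorname{span}\{S_x(\hat x)\}$ for some $\hat x\in\mathbb X$, then $(\hat x,0)\in\mathcal S$.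
   Context: Notation: $F_x$ is the gradient of a scalar function $F$; for a skew-symmetric $J\in\mathbb R^{n\times n}$, $\{v,w\}_J(x):=v_x(x)^\top Jw_x(x)$. A reversible-irreversible port-Hamiltonian system (RIPHS) on an open set $\mathbb X\subset\mathbb R^n$ is given by: a locally Lipschitz map $J_0:\mathbb X\to\mathbb R^{n\times n}$ with skew-symmetric values; a differentiable Hamiltonian $H:\mathbb X\to\mathbb R$ with locally Lipschitz gradient $H_x$; a differentiable entropy $S:\mathbb X\to\mathbb R$ with locally Lipschitz gradient $S_x$ and $J_0(x)S_x(x)=0$ for all $x\in\mathbb X$; constant skew-symmetric matrices $J_1,\dots,J_N\in\mathbb R^{n\times n}$; functions $\gamma_1,\dots,\gamma_N:\mathbb R^{2n}\to\mathbb R$ such that $x\mapsto\gamma_k(x,H_x(x))$ is positive and locally Lipschitz on $\mathbb X$; a locally Lipschitz map $g:\mathbb R^{2n}\to\mathbb R^{n\times m}$; and the state equation $\dot x=f(x,u)$ with $$f(x,u)=\Big(J_0(x)+\sum_{k=1}^N\gamma_k(x,H_x(x))\{S,H\}_{J_k}(x)\,J_k\Big)H_x(x)+g(x,H_x(x))u.$$ Outputs: $y_H=g(x,H_x(x))^\top H_x(x)$, $y_S=g(x,H_x(x))^\top S_x(x)$. Stage cost: $\ell_{\alpha_1,\alpha_2}(x,u)=[\alpha_1y_H-\alpha_2T_0y_S]^\top u$. Thermodynamic equilibria: $\mathcal T=\{x\in\mathbb X:\{S,H\}_{J_k}(x)=0\text{ for all }k=1,\dots,N\}$. *)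

theory Defs
  imports "HOL-Analysis.Analysis"
begin

(* local_lipschitz speaks about time-dependent maps; the time set is a single point here. *)
definition locally_lipschitz_on :: "'a::metric_space set \<Rightarrow> ('a \<Rightarrow> 'b::metric_space) \<Rightarrow> bool" where
  "locally_lipschitz_on X f \<longleftrightarrow> local_lipschitz {0::real} X (\<lambda>_. f)"

definition skew_symmetric :: "real^'n^'n \<Rightarrow> bool" where
  "skew_symmetric A \<longleftrightarrow> transpose A = - A"

(* Only meaningful at points where F is differentiable; there the vector is unique. *)
definition gradient :: "('a::real_inner \<Rightarrow> real) \<Rightarrow> 'a \<Rightarrow> 'a" where
  "gradient F x = (THE D. GDERIV F x :> D)"

definition bracket ::
  "real^'n^'n \<Rightarrow> (real^'n \<Rightarrow> real) \<Rightarrow> (real^'n \<Rightarrow> real) \<Rightarrow> real^'n \<Rightarrow> real" where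
  "bracket J v w x = gradient v x \<bullet> (J *v gradient w x)"

(* The data (X, J_0, H, S, N, (J_k), (gamma_k), g). The space R^(2n) is rendered as the
   product (real^'n) \<times> (real^'n); matrices in R^(n x m) have type real^'m^'n. Of Jirr and
   gam only the indices 1..N are relevant. *)
record ('n, 'm) riphs_data =
  states :: "(real^'n) set"
  Jrev :: "real^'n \<Rightarrow> real^'n^'n"
  Ham :: "real^'n \<Rightarrow> real"
  Ent :: "real^'n \<Rightarrow> real"
  Nirr :: nat
  Jirr :: "nat \<Rightarrow> real^'n^'n"
  gam :: "nat \<Rightarrow> (real^'n) \<times> (real^'n) \<Rightarrow> real"
  inp :: "(real^'n) \<times> (real^'n) \<Rightarrow> real^'m^'n"

definition RIPHS :: "('n::finite, 'm::finite) riphs_data \<Rightarrow> bool" where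
  "RIPHS P \<longleftrightarrow>
     open (states P) \<and>
     locally_lipschitz_on (states P) (Jrev P) \<and>
     (\<forall>x\<in>states P. skew_symmetric (Jrev P x)) \<and>
     (\<forall>x\<in>states P. Ham P differentiable (at x)) \<and>
     locally_lipschitz_on (states P) (gradient (Ham P)) \<and>
     (\<forall>x\<in>states P. Ent P differentiable (at x)) \<and>
     locally_lipschitz_on (states P) (gradient (Ent P)) \<and>
     (\<forall>x\<in>states P. Jrev P x *v gradient (Ent P) x = 0) \<and>
     (\<forall>k\<in>{1..Nirr P}. skew_symmetric (Jirr P k)) \<and>
     (\<forall>k\<in>{1..Nirr P}. \<forall>x\<in>states P. gam P k (x, gradient (Ham P) x) > 0) \<and>
     (\<forall>k\<in>{1..Nirr P}.
        locally_lipschitz_on (states P) (\<lambda>x. gam P k (x, gradient (Ham P) x))) \<and>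
     locally_lipschitz_on UNIV (inp P)"

definition rhs :: "('n::finite, 'm::finite) riphs_data \<Rightarrow> real^'n \<Rightarrow> real^'m \<Rightarrow> real^'n" where
  "rhs P x u =
     (Jrev P x + (\<Sum>k=1..Nirr P.
        (gam P k (x, gradient (Ham P) x) * bracket (Jirr P k) (Ent P) (Ham P) x) *\<^sub>R Jirr P k))
       *v gradient (Ham P) x
     + inp P (x, gradient (Ham P) x) *v u"

definition output_H :: "('n::finite, 'm::finite) riphs_data \<Rightarrow> real^'n \<Rightarrow> real^'m" where
  "output_H P x = transpose (inp P (x, gradient (Ham P) x)) *v gradient (Ham P) x"

definition output_S :: "('n::finite, 'm::finite) riphs_data \<Rightarrow> real^'n \<Rightarrow> real^'m" where
  "output_S P x = transpose (inp P (x, gradient (Ham P) x)) *v gradient (Ent P) x"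

definition stage_cost ::
  "('n::finite, 'm::finite) riphs_data \<Rightarrow> real \<Rightarrow> real \<Rightarrow> real \<Rightarrow> real^'n \<Rightarrow> real^'m \<Rightarrow> real" where
  "stage_cost P T\<^sub>0 \<alpha>\<^sub>1 \<alpha>\<^sub>2 x u =
     (\<alpha>\<^sub>1 *\<^sub>R output_H P x - (\<alpha>\<^sub>2 * T\<^sub>0) *\<^sub>R output_S P x) \<bullet> u"

definition thermo_equilibria :: "('n::finite, 'm::finite) riphs_data \<Rightarrow> (real^'n) set" where
  "thermo_equilibria P =
     {x \<in> states P. \<forall>k\<in>{1..Nirr P}. bracket (Jirr P k) (Ent P) (Ham P) x = 0}"

definition steady_states ::
  "('n::finite, 'm::finite) riphs_data \<Rightarrow> (real^'m) set \<Rightarrow> ((real^'n) \<times> (real^'m)) set" where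
  "steady_states P U = {(x, u). x \<in> states P \<and> u \<in> U \<and> rhs P x u = 0}"

(* Infimum in the extended reals, hence \<infinity> if there is no steady state. *)
definition steady_value ::
  "('n::finite, 'm::finite) riphs_data \<Rightarrow> (real^'m) set \<Rightarrow> real \<Rightarrow> real \<Rightarrow> real \<Rightarrow> ereal" where
  "steady_value P U T\<^sub>0 \<alpha>\<^sub>1 \<alpha>\<^sub>2 =
     (INF (x, u)\<in>steady_states P U. ereal (stage_cost P T\<^sub>0 \<alpha>\<^sub>1 \<alpha>\<^sub>2 x u))"

definition optimal_steady_states ::
  "('n::finite, 'm::finite) riphs_data \<Rightarrow> (real^'m) set \<Rightarrow> real \<Rightarrow> real \<Rightarrow> real
    \<Rightarrow> ((real^'n) \<times> (real^'m)) set" where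
  "optimal_steady_states P U T\<^sub>0 \<alpha>\<^sub>1 \<alpha>\<^sub>2 =
     {z. is_arg_min (\<lambda>(x, u). stage_cost P T\<^sub>0 \<alpha>\<^sub>1 \<alpha>\<^sub>2 x u) (\<lambda>z. z \<in> steady_states P U) z}"

(* The value v is attained as a minimum. The state space is open, so the infimum v may fail
   to be attained: on x_1 > 0 in R^2 with H = x_1^2/2, S = x_2, J_0 = 0, N = 1, gamma_1 = 1,
   J_1 = ((0,1),(-1,0)), g = id and U the closed unit ball, the cost of the steady states is
   alpha_2 T_0 x_1^2, with infimum 0 but without a minimizer. *)
definition steady_minimum ::
  "('n::finite, 'm::finite) riphs_data \<Rightarrow> (real^'m) set \<Rightarrow> real \<Rightarrow> real \<Rightarrow> real \<Rightarrow> ereal \<Rightarrow> bool" where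
  "steady_minimum P U T\<^sub>0 \<alpha>\<^sub>1 \<alpha>\<^sub>2 v \<longleftrightarrow>
     optimal_steady_states P U T\<^sub>0 \<alpha>\<^sub>1 \<alpha>\<^sub>2 \<noteq> {} \<and> steady_value P U T\<^sub>0 \<alpha>\<^sub>1 \<alpha>\<^sub>2 = v"

definition equilibrium_steady_states ::
  "('n::finite, 'm::finite) riphs_data \<Rightarrow> (real^'m) set \<Rightarrow> ((real^'n) \<times> (real^'m)) set" where
  "equilibrium_steady_states P U =
     {(x, u). x \<in> thermo_equilibria P \<and> u \<in> U \<and>
        inp P (x, gradient (Ham P) x) *v u = - (Jrev P x *v gradient (Ham P) x)}"

end

(* Skew-symmetry of the full structure matrix gives H_x . f = H_x . g u, and J_0 S_x = 0 together
   with skew-symmetry of J_0 makes S_x . J_0 H_x vanish. Hence at a steady state y_H . u = 0 and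
   y_S . u is minus the entropy production, so that the stage cost is a positive multiple of a
   sum of nonnegative terms whose vanishing means that the state is a thermodynamic equilibrium. *)
theory Submission
  imports Defs
begin

lemma sum_scaleR_matrix_vector:
  fixes A :: "'k \<Rightarrow> real^'m^'n"
  shows "(\<Sum>k\<in>K. c k *\<^sub>R A k) *v x = (\<Sum>k\<in>K. c k *\<^sub>R (A k *v x))"
  by (induction K rule: infinite_finite_induct)
    (simp_all add: matrix_vector_mult_add_rdistrib scaleR_matrix_vector_assoc)

lemma skew_symmetric_inner:
  fixes A :: "real^'n^'n"
  assumes "skew_symmetric A"
  shows "x \<bullet> (A *v y) = - ((A *v x) \<bullet> y)"
proof -
  have "x \<bullet> (A *v y) = (transpose A *v x) \<bullet> y"
    by (simp add: dot_lmul_matrix)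
  \<comment> \<open>Subtracting \<open>A\<close> from the matrix 0 in the distributive law yields
    \<open>(- A) *v x = - (A *v x)\<close>.\<close>
  also have "\<dots> = - ((A *v x) \<bullet> y)"
    using assms matrix_vector_mult_diff_rdistrib[of 0 A x] by (simp add: skew_symmetric_def)
  finally show ?thesis .
qed

lemma skew_symmetric_inner_self:
  fixes A :: "real^'n^'n"
  assumes "skew_symmetric A"
  shows "x \<bullet> (A *v x) = 0"
  using skew_symmetric_inner[OF assms, of x x] by (simp add: inner_commute)

text \<open>The internal entropy production: the growth rate of the entropy along the flow when u =
  0.\<close>

definition entropy_production :: "('n::finite, 'm::finite) riphs_data \<Rightarrow> real^'n \<Rightarrow> real" where
  "entropy_production P x = (\<Sum>k=1..Nirr P. gam P k (x, gradient (Ham P) x) *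
     (bracket (Jirr P k) (Ent P) (Ham P) x)\<^sup>2)"

lemma rhs_expand:
  "rhs P x u = Jrev P x *v gradient (Ham P) x +
     (\<Sum>k=1..Nirr P. (gam P k (x, gradient (Ham P) x) * bracket (Jirr P k) (Ent P) (Ham P) x) *\<^sub>R
        (Jirr P k *v gradient (Ham P) x)) +
     inp P (x, gradient (Ham P) x) *v u"
  by (simp add: rhs_def matrix_vector_mult_add_rdistrib sum_scaleR_matrix_vector)

text \<open>A skew-symmetric matrix pairs every vector with itself to 0, so \<open>Jrev\<close> and
  each \<open>Jirr\<close> term do no work and only the power supplied through the input
  remains.\<close>

lemma energy_balance:
  assumes "RIPHS P" and "x \<in> states P"
  shows "gradient (Ham P) x \<bullet> rhs P x u = output_H P x \<bullet> u"
proof -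
  have "gradient (Ham P) x \<bullet> (Jrev P x *v gradient (Ham P) x) = 0"
    using assms by (auto simp: RIPHS_def intro: skew_symmetric_inner_self)
  moreover have "gradient (Ham P) x \<bullet> (Jirr P k *v gradient (Ham P) x) = 0"
    if "k \<in> {1..Nirr P}" for k
    using assms that by (auto simp: RIPHS_def intro: skew_symmetric_inner_self)
  ultimately show ?thesis
    by (simp add: rhs_expand output_H_def dot_lmul_matrix inner_add_right
        inner_sum_right)
qed

text \<open>The bracket in the coefficient of J_k is itself S_x . J_k H_x, so pairing the k-th
  irreversible term with S_x produces a square. The reversible term drops out after J_0 is moved
  onto S_x.\<close>

lemma entropy_balance:
  assumes "RIPHS P" and "x \<in> states P"
  shows "gradient (Ent P) x \<bullet> rhs P x u = entropy_production P x + output_S P x \<bullet> u"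
proof -
  have "skew_symmetric (Jrev P x)" and "Jrev P x *v gradient (Ent P) x = 0"
    using assms by (auto simp: RIPHS_def)
  then have "gradient (Ent P) x \<bullet> (Jrev P x *v gradient (Ham P) x) = 0"
    by (simp add: skew_symmetric_inner)
  then show ?thesis
    by (simp add: rhs_expand entropy_production_def output_S_def dot_lmul_matrix
        inner_add_right inner_sum_right bracket_def power2_eq_square mult.assoc)
qed

lemma stage_cost_steady:
  assumes "RIPHS P" and "x \<in> states P" and "rhs P x u = 0"
  shows "stage_cost P T\<^sub>0 \<alpha>\<^sub>1 \<alpha>\<^sub>2 x u = \<alpha>\<^sub>2 * T\<^sub>0 * entropy_production P x"
proof -
  have "output_H P x \<bullet> u = 0"
    using energy_balance[OF assms(1,2), of u] assms(3) by simp
  moreover have "output_S P x \<bullet> u = - entropy_production P x"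
    using entropy_balance[OF assms(1,2), of u] assms(3) by simp
  ultimately show ?thesis
    by (simp add: stage_cost_def inner_diff_left)
qed

lemma entropy_production_nonneg:
  assumes "RIPHS P" and "x \<in> states P"
  shows "entropy_production P x \<ge> 0"
  using assms unfolding entropy_production_def RIPHS_def
  by (intro sum_nonneg mult_nonneg_nonneg) (auto intro: less_imp_le)

text \<open>A sum of nonnegative terms vanishes only termwise, and strict positivity of the gamma_k
  then forces every bracket to vanish.\<close>

lemma entropy_production_eq_0_iff:
  assumes "RIPHS P" and "x \<in> states P"
  shows "entropy_production P x = 0 \<longleftrightarrow> x \<in> thermo_equilibria P"
proof -
  have pos: "gam P k (x, gradient (Ham P) x) > 0" if "k \<in> {1..Nirr P}" for k
    using assms that by (auto simp: RIPHS_def)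
  have "entropy_production P x = 0 \<longleftrightarrow>
    (\<forall>k\<in>{1..Nirr P}. gam P k (x, gradient (Ham P) x) *
       (bracket (Jirr P k) (Ent P) (Ham P) x)\<^sup>2 = 0)"
    unfolding entropy_production_def
    by (intro sum_nonneg_eq_0_iff mult_nonneg_nonneg) (auto intro: less_imp_le[OF pos])
  also have "\<dots> \<longleftrightarrow> (\<forall>k\<in>{1..Nirr P}. bracket (Jirr P k) (Ent P) (Ham P) x = 0)"
    using pos by (intro ball_cong) fastforce+
  finally show ?thesis
    using assms by (simp add: thermo_equilibria_def)
qed

lemma rhs_thermo_equilibria:
  assumes "x \<in> thermo_equilibria P"
  shows "rhs P x u = Jrev P x *v gradient (Ham P) x + inp P (x, gradient (Ham P) x) *v u"
  using assms by (simp add: rhs_expand thermo_equilibria_def)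

text \<open>At a thermodynamic equilibrium the irreversible part of f is zero, so the equation
  defining the set is exactly f = 0. The optimization claims thereby concern the zero set of a
  nonnegative function.\<close>

lemma mem_equilibrium_steady_states_iff:
  assumes "RIPHS P"
  shows "(x, u) \<in> equilibrium_steady_states P U \<longleftrightarrow>
    (x, u) \<in> steady_states P U \<and> entropy_production P x = 0"
proof -
  have "(x, u) \<in> equilibrium_steady_states P U \<longleftrightarrow>
    x \<in> thermo_equilibria P \<and> u \<in> U \<and> rhs P x u = 0"
    by (auto simp: equilibrium_steady_states_def rhs_thermo_equilibria add_eq_0_iff)
  moreover have "x \<in> states P" if "x \<in> thermo_equilibria P"
    using that by (simp add: thermo_equilibria_def)
  ultimately show ?thesis
    using entropy_production_eq_0_iff[OF assms, of x] by (auto simp: steady_states_def)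
qed

text \<open>With H_x = c S_x, each bracket becomes c times S_x . J_k S_x = 0, and J_0 H_x = c J_0
  S_x = 0, which the zero input balances.\<close>

lemma span_gradient_imp_equilibrium:
  assumes "RIPHS P" and "x \<in> states P" and "0 \<in> U"
    and "gradient (Ham P) x \<in> span {gradient (Ent P) x}"
  shows "(x, 0) \<in> equilibrium_steady_states P U"
proof -
  obtain c where c: "gradient (Ham P) x = c *\<^sub>R gradient (Ent P) x"
    using assms(4) by (auto simp: span_singleton)
  have "bracket (Jirr P k) (Ent P) (Ham P) x = 0" if "k \<in> {1..Nirr P}" for k
    using assms(1) that
    by (auto simp: bracket_def c RIPHS_def matrix_vector_mult_scaleR skew_symmetric_inner_self)
  moreover have "Jrev P x *v gradient (Ham P) x = 0"
    using assms(1,2) by (auto simp: c RIPHS_def matrix_vector_mult_scaleR)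
  ultimately show ?thesis
    using assms(2,3) by (simp add: equilibrium_steady_states_def thermo_equilibria_def)
qed

theorem proposition3p1:
  fixes P :: "('n::finite, 'm::finite) riphs_data"
    and U :: "(real^'m) set"
    and T\<^sub>0 \<alpha>\<^sub>1 \<alpha>\<^sub>2 :: real
  assumes "RIPHS P"
    and "compact U" and "convex U" and "0 \<in> interior U"
    and "\<alpha>\<^sub>1 > 0" and "\<alpha>\<^sub>2 > 0" and "T\<^sub>0 > 0"
  shows
    "(\<forall>x\<in>states P. \<forall>u\<in>U. rhs P x u = 0 \<longrightarrow>
        stage_cost P T\<^sub>0 \<alpha>\<^sub>1 \<alpha>\<^sub>2 x u =
          \<alpha>\<^sub>2 * T\<^sub>0 * (\<Sum>k=1..Nirr P. gam P k (x, gradient (Ham P) x) *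
            (bracket (Jirr P k) (Ent P) (Ham P) x)\<^sup>2) \<and>
        \<alpha>\<^sub>2 * T\<^sub>0 * (\<Sum>k=1..Nirr P. gam P k (x, gradient (Ham P) x) *
            (bracket (Jirr P k) (Ent P) (Ham P) x)\<^sup>2) \<ge> 0) \<and>
     steady_value P U T\<^sub>0 \<alpha>\<^sub>1 \<alpha>\<^sub>2 \<ge> 0 \<and>
     (steady_minimum P U T\<^sub>0 \<alpha>\<^sub>1 \<alpha>\<^sub>2 0 \<longleftrightarrow> equilibrium_steady_states P U \<noteq> {}) \<and>
     (equilibrium_steady_states P U \<noteq> {} \<longrightarrow>
        equilibrium_steady_states P U = optimal_steady_states P U T\<^sub>0 \<alpha>\<^sub>1 \<alpha>\<^sub>2) \<and>
     (\<forall>x\<in>states P. gradient (Ham P) x \<in> span {gradient (Ent P) x} \<longrightarrow>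
        (x, 0) \<in> equilibrium_steady_states P U)"
proof -
  let ?cost = "\<lambda>(x, u). stage_cost P T\<^sub>0 \<alpha>\<^sub>1 \<alpha>\<^sub>2 x u"
  let ?Z = "steady_states P U" and ?E = "equilibrium_steady_states P U"
    and ?O = "optimal_steady_states P U T\<^sub>0 \<alpha>\<^sub>1 \<alpha>\<^sub>2" and ?V = "steady_value P U T\<^sub>0 \<alpha>\<^sub>1 \<alpha>\<^sub>2"
  have cost: "stage_cost P T\<^sub>0 \<alpha>\<^sub>1 \<alpha>\<^sub>2 x u = \<alpha>\<^sub>2 * T\<^sub>0 * entropy_production P x"
    "\<alpha>\<^sub>2 * T\<^sub>0 * entropy_production P x \<ge> 0" if "x \<in> states P" "rhs P x u = 0" for x u
    using that assms by (simp_all add: stage_cost_steady entropy_production_nonneg)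
  have nonneg: "?cost z \<ge> 0" if "z \<in> ?Z" for z
    using that cost by (fastforce simp: steady_states_def)
  \<comment> \<open>As \<alpha>\<open>\<^sub>2 * T\<^sub>0\<close> is nonzero, the cost of a steady
    state vanishes exactly when its entropy production does.\<close>
  have E_iff: "z \<in> ?E \<longleftrightarrow> z \<in> ?Z \<and> ?cost z = 0" for z
    using mem_equilibrium_steady_states_iff[OF \<open>RIPHS P\<close>] cost assms
    by (cases z) (auto simp: steady_states_def)
  have O_iff: "z \<in> ?O \<longleftrightarrow> z \<in> ?Z \<and> (\<forall>w\<in>?Z. ?cost z \<le> ?cost w)" for z
    by (auto simp: optimal_steady_states_def is_arg_min_linorder)
  have V: "?V = (INF z\<in>?Z. ereal (?cost z))"
    by (simp add: steady_value_def case_prod_unfold)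
  \<comment> \<open>This includes the case without steady states, where the infimum is
    \<infinity>.\<close>
  have V_nonneg: "?V \<ge> 0"
    unfolding V by (rule INF_greatest) (simp add: nonneg)
  have V_optimal: "?V = ereal (?cost z)" if "z \<in> ?O" for z
    unfolding V using that O_iff[of z] by (intro antisym INF_greatest INF_lower) auto
  have E_sub: "?E \<subseteq> ?O"
    using E_iff O_iff nonneg by (metis (no_types, lifting) subsetI)
  have E_eq: "?E = ?O" if "?E \<noteq> {}"
  proof -
    obtain e where "e \<in> ?Z" "?cost e = 0"
      using \<open>?E \<noteq> {}\<close> E_iff by blast
    \<comment> \<open>A minimizer costs at most \<open>?cost e = 0\<close>, and no steady state
      costs less than 0.\<close>
    then have "z \<in> ?E" if "z \<in> ?O" for z
      using that E_iff[of z] O_iff[of z] nonneg[of z] by fastforce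
    with E_sub show ?thesis
      by blast
  qed
  have "steady_minimum P U T\<^sub>0 \<alpha>\<^sub>1 \<alpha>\<^sub>2 0 \<longleftrightarrow> ?E \<noteq> {}"
  proof
    \<comment> \<open>Attainment, which is part of \<open>steady_minimum\<close>, supplies the
      minimizer; its cost equals the value 0, so it lies in \<open>?E\<close>.\<close>
    assume "steady_minimum P U T\<^sub>0 \<alpha>\<^sub>1 \<alpha>\<^sub>2 0"
    then obtain z where "z \<in> ?O" "?V = 0"
      by (auto simp: steady_minimum_def)
    then have "z \<in> ?E"
      using V_optimal[of z] E_iff[of z] O_iff[of z] by simp
    then show "?E \<noteq> {}"
      by blast
  next
    assume "?E \<noteq> {}"
    then obtain e where "e \<in> ?E"
      by blast
    then have "e \<in> ?O" and "?V = 0"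
      using E_sub V_optimal[of e] E_iff[of e] by (auto simp: zero_ereal_def)
    then show "steady_minimum P U T\<^sub>0 \<alpha>\<^sub>1 \<alpha>\<^sub>2 0"
      by (auto simp: steady_minimum_def)
  qed
  \<comment> \<open>This makes the zero input admissible for the claim about the span.\<close>
  moreover have "0 \<in> U"
    using \<open>0 \<in> interior U\<close> interior_subset by blast
  ultimately show ?thesis
    using cost V_nonneg E_eq span_gradient_imp_equilibrium[OF \<open>RIPHS P\<close>]
    unfolding entropy_production_def by blast
qed

end
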